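(* Let $N\ge 2$ and $K\ge 1$ be integers, let $\alpha_k,\beta_k,\delta_k>0$ for $k=1,\dots,K$, with $\alpha_k=\beta_k$ for all $k=1,\dots,K$, and let $x(t)$, $t\in(-\infty,\infty)$, be the stationary inhomogeneous symmetric simple exclusion process with open boundaries on $G=\{0,1,\dots,K\}^N$ with these rates. Then the stochastic processes $x(t)$ and $\tilde x(t)=x(-t)$, $t\in(-\infty,\infty)$, are stochastically equivalent (i.e. they have the same finite-dimensional distributions).
   Context: The process: $x(t)=(x_1(t),\dots,x_N(t))$ is a continuous-time Markov chain with finite state space $G=\{0,1,\dots,K\}^N$. Sites are numbered $1,\dots,N$ from left to right; $x_i=0$ means that site $i$ is vacant, and $x_i=k\in\{1,\dots,K\}$ means that site $i$ is occupied by a particle of type $k$. The transitions and their rates are, for each $k=1,\dots,K$: (arrival) for $i=1$ and for $i=N$, if $x_i=0$, then $x_i$ changes to $k$ at rate $\alpha_k$ (a particle of type $k$ enters from outside); (departure) for $i=1$ and for $i=N$, if $x_i=k$, then $x_i$ changes to $0$ at rate $\beta_k$ (the particle leaves the system); (hop) for any two adjacent sites $i,j\in\{1,\dots,N\}$, $|i-j|=1$, if $x_i=k$ and $x_j=0$, then the particle in site $i$ moves to site $j$ (so $x_i$ becomes $0$ and $x_j$ becomes $k$) at rate $\delta_k$. No other transitions occur. The process is considered in the stationary mode on the doubly infinite time interval $(-\infty,\infty)$: for every $t$, the distribution of $x(t)$ is the stationary distribution of the chain. *)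

theory Defs
  imports "HOL-Probability.Probability"
begin

section \<open>Continuous-time Markov chains on a finite state space\<close>

text \<open>
  A chain is given by its off-diagonal transition rates; \<open>r x x\<close> is never used. The generator
  has the rates off the diagonal and row sums \<open>0\<close>.
\<close>

definition generator :: "'s set \<Rightarrow> ('s \<Rightarrow> 's \<Rightarrow> real) \<Rightarrow> 's \<Rightarrow> 's \<Rightarrow> real" where
  "generator G r x y = (if x = y then - (\<Sum>z\<in>G - {x}. r x z) else r x y)"

text \<open>
  The last clause says \<open>p h x y = of_bool (x = y) + h * generator G r x y + o(h)\<close> as \<open>h\<close> decreases
  to \<open>0\<close>. Only the values \<open>p t x y\<close> with \<open>t \<ge> 0\<close> and \<open>x, y \<in> G\<close> are constrained.
\<close>

definition transition_function ::
    "'s set \<Rightarrow> ('s \<Rightarrow> 's \<Rightarrow> real) \<Rightarrow> (real \<Rightarrow> 's \<Rightarrow> 's \<Rightarrow> real) \<Rightarrow> bool" where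
  "transition_function G r p \<longleftrightarrow>
     (\<forall>t\<ge>0. \<forall>x\<in>G. (\<forall>y\<in>G. 0 \<le> p t x y) \<and> (\<Sum>y\<in>G. p t x y) = 1) \<and>
     (\<forall>x\<in>G. \<forall>y\<in>G. p 0 x y = of_bool (x = y)) \<and>
     (\<forall>s\<ge>0. \<forall>t\<ge>0. \<forall>x\<in>G. \<forall>y\<in>G. p (s + t) x y = (\<Sum>z\<in>G. p s x z * p t z y)) \<and>
     (\<forall>x\<in>G. \<forall>y\<in>G. ((\<lambda>t. p t x y) has_real_derivative generator G r x y) (at_right 0))"

definition stationary_distribution ::
    "'s set \<Rightarrow> (real \<Rightarrow> 's \<Rightarrow> 's \<Rightarrow> real) \<Rightarrow> ('s \<Rightarrow> real) \<Rightarrow> bool" where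
  "stationary_distribution G p \<pi> \<longleftrightarrow>
     (\<forall>x\<in>G. 0 \<le> \<pi> x) \<and> (\<Sum>x\<in>G. \<pi> x) = 1 \<and>
     (\<forall>t\<ge>0. \<forall>y\<in>G. (\<Sum>x\<in>G. \<pi> x * p t x y) = \<pi> y)"

text \<open>
  Time-homogeneous Markov property on the whole time line, with \<open>J\<close> ranging over the finite sets of
  past observation times. Conditioning is only on events of positive probability.
\<close>

definition markov_chain ::
    "'w measure \<Rightarrow> 's set \<Rightarrow> (real \<Rightarrow> 's \<Rightarrow> 's \<Rightarrow> real) \<Rightarrow> (real \<Rightarrow> 'w \<Rightarrow> 's) \<Rightarrow> bool" where
  "markov_chain M G p X \<longleftrightarrow>
     (\<forall>t. X t \<in> measurable M (count_space G)) \<and>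
     (\<forall>s t J a. \<forall>x\<in>G. \<forall>y\<in>G.
        s < t \<longrightarrow> finite J \<longrightarrow> J \<subseteq> {..<s} \<longrightarrow>
        \<P>(\<omega> in M. (\<forall>u\<in>J. X u \<omega> = a u) \<and> X s \<omega> = x) > 0 \<longrightarrow>
        \<P>(\<omega> in M. X t \<omega> = y \<bar> (\<forall>u\<in>J. X u \<omega> = a u) \<and> X s \<omega> = x) = p (t - s) x y)"

definition stationary_markov_chain ::
    "'w measure \<Rightarrow> 's set \<Rightarrow> ('s \<Rightarrow> 's \<Rightarrow> real) \<Rightarrow> (real \<Rightarrow> 'w \<Rightarrow> 's) \<Rightarrow> bool" where
  "stationary_markov_chain M G r X \<longleftrightarrow>
     (\<exists>p \<pi>. transition_function G r p \<and> markov_chain M G p X \<and>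
        stationary_distribution G p \<pi> \<and>
        (\<forall>t. \<forall>x\<in>G. \<P>(\<omega> in M. X t \<omega> = x) = \<pi> x))"

definition same_fdd ::
    "'w measure \<Rightarrow> ('t \<Rightarrow> 'w \<Rightarrow> 's) \<Rightarrow> 'v measure \<Rightarrow> ('t \<Rightarrow> 'v \<Rightarrow> 's) \<Rightarrow> 's measure \<Rightarrow> bool" where
  "same_fdd M X M' Y S \<longleftrightarrow>
     (\<forall>J. finite J \<longrightarrow>
        distr M (Pi\<^sub>M J (\<lambda>_. S)) (\<lambda>\<omega>. \<lambda>t\<in>J. X t \<omega>) =
        distr M' (Pi\<^sub>M J (\<lambda>_. S)) (\<lambda>\<omega>. \<lambda>t\<in>J. Y t \<omega>))"

section \<open>The inhomogeneous symmetric simple exclusion process with open boundaries\<close>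

definition sep_states :: "nat \<Rightarrow> nat \<Rightarrow> (nat \<Rightarrow> nat) set" where
  "sep_states N K = {1..N} \<rightarrow>\<^sub>E {0..K}"

text \<open>
  The rate from \<open>x\<close> to \<open>y\<close> is the total rate of all arrivals, departures and hops that turn \<open>x\<close>
  into \<open>y\<close>. For \<open>N = 1\<close> the set \<open>{1, N}\<close> would collapse the two boundaries into one.
\<close>

definition sep_rate ::
    "nat \<Rightarrow> nat \<Rightarrow> (nat \<Rightarrow> real) \<Rightarrow> (nat \<Rightarrow> real) \<Rightarrow> (nat \<Rightarrow> real) \<Rightarrow>
     (nat \<Rightarrow> nat) \<Rightarrow> (nat \<Rightarrow> nat) \<Rightarrow> real" where
  "sep_rate N K \<alpha> \<beta> \<delta> x y =
     (\<Sum>k\<in>{1..K}.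
        (\<Sum>i\<in>{1, N}. if x i = 0 \<and> y = x(i := k) then \<alpha> k else 0) +
        (\<Sum>i\<in>{1, N}. if x i = k \<and> y = x(i := 0) then \<beta> k else 0) +
        (\<Sum>i\<in>{1..N}. \<Sum>j\<in>{1..N}.
           if (j = i + 1 \<or> i = j + 1) \<and> x i = k \<and> x j = 0 \<and> y = x(i := 0, j := k)
           then \<delta> k else 0))"

end

theory Submission
  imports Defs
begin

text \<open>
  For \<open>\<alpha> = \<beta>\<close> the rates are symmetric, because a departure undoes an arrival and a hop undoes a hop.
  Symmetric rates have symmetric transition probabilities \<open>p t\<close>. If \<open>\<pi>\<close> is stationary for a symmetric
  stochastic matrix \<open>P\<close>, then \<open>\<Sum>x y. P x y * (\<pi> x - \<pi> y)\<^sup>2 = 0\<close>, so \<open>\<pi> x * P x y = \<pi> y * P y x\<close>;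
  this gives detailed balance without irreducibility and without computing \<open>\<pi>\<close>. Detailed balance
  turns the Markov property into the one for reversed time, with the same transition function.
\<close>

section \<open>Symmetric rates\<close>

lemma stationary_symmetric_detailed_balance:
  fixes P :: "'s \<Rightarrow> 's \<Rightarrow> real"
  assumes fin: "finite G"
    and nonneg: "\<And>x y. x \<in> G \<Longrightarrow> y \<in> G \<Longrightarrow> 0 \<le> P x y"
    and rows: "\<And>x. x \<in> G \<Longrightarrow> (\<Sum>y\<in>G. P x y) = 1"
    and sym: "\<And>x y. x \<in> G \<Longrightarrow> y \<in> G \<Longrightarrow> P x y = P y x"
    and stat: "\<And>y. y \<in> G \<Longrightarrow> (\<Sum>x\<in>G. \<pi> x * P x y) = \<pi> y"
    and x: "x \<in> G" and y: "y \<in> G"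
  shows "\<pi> x * P x y = \<pi> y * P y x"
proof -
  \<comment> \<open>Expanding the square in \<open>P x y * (\<pi> x - \<pi> y)\<^sup>2\<close> gives
    three double sums, all reducing to the sum of \<open>(\<pi> x)\<^sup>2\<close>: the first by the
    row sums, the second because symmetry turns column sums into row sums, the mixed one by
    stationarity. Hence they cancel.\<close>
  have A: "(\<Sum>x\<in>G. \<Sum>y\<in>G. P x y * (\<pi> x)\<^sup>2) = (\<Sum>x\<in>G. (\<pi> x)\<^sup>2)"
    by (simp add: sum_distrib_right[symmetric] rows)
  have "(\<Sum>x\<in>G. \<Sum>y\<in>G. P x y * (\<pi> y)\<^sup>2) = (\<Sum>y\<in>G. \<Sum>x\<in>G. P x y * (\<pi> y)\<^sup>2)"
    by (rule sum.swap)
  also have "\<dots> = (\<Sum>y\<in>G. \<Sum>x\<in>G. P y x * (\<pi> y)\<^sup>2)"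
    by (intro sum.cong refl) (simp add: sym)
  finally have B: "(\<Sum>x\<in>G. \<Sum>y\<in>G. P x y * (\<pi> y)\<^sup>2) = (\<Sum>x\<in>G. (\<pi> x)\<^sup>2)"
    using A by simp
  have "(\<Sum>x\<in>G. \<Sum>y\<in>G. P x y * (\<pi> x * \<pi> y)) = (\<Sum>y\<in>G. \<Sum>x\<in>G. P x y * (\<pi> x * \<pi> y))"
    by (rule sum.swap)
  also have "\<dots> = (\<Sum>y\<in>G. (\<Sum>x\<in>G. \<pi> x * P x y) * \<pi> y)"
    by (simp add: sum_distrib_left mult_ac)
  finally have C: "(\<Sum>x\<in>G. \<Sum>y\<in>G. P x y * (\<pi> x * \<pi> y)) = (\<Sum>x\<in>G. (\<pi> x)\<^sup>2)"
    by (simp add: stat power2_eq_square)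
  have "(\<Sum>x\<in>G. \<Sum>y\<in>G. P x y * (\<pi> x - \<pi> y)\<^sup>2) =
      (\<Sum>x\<in>G. \<Sum>y\<in>G. P x y * (\<pi> x)\<^sup>2) + (\<Sum>x\<in>G. \<Sum>y\<in>G. P x y * (\<pi> y)\<^sup>2)
        - 2 * (\<Sum>x\<in>G. \<Sum>y\<in>G. P x y * (\<pi> x * \<pi> y))"
    by (simp only: sum.distrib[symmetric] sum_subtractf[symmetric] sum_distrib_left)
      (simp add: power2_diff algebra_simps)
  then have "(\<Sum>x\<in>G. \<Sum>y\<in>G. P x y * (\<pi> x - \<pi> y)\<^sup>2) = 0"
    using A B C by simp
  \<comment> \<open>A vanishing sum of nonnegative terms has only zero terms, so either
    \<open>P x y = 0\<close> or \<open>\<pi> x = \<pi> y\<close>.\<close>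
  then have "P x y * (\<pi> x - \<pi> y)\<^sup>2 = 0"
    using x y fin nonneg by (simp add: sum_nonneg_eq_0_iff sum_nonneg)
  then show ?thesis
    using sym[OF x y] by auto
qed

text \<open>Averaging over two probability vectors costs no factor depending on the size of
  \<open>G\<close>. This keeps the error of each telescoping step at \<open>e * h\<close>, so that
  \<open>n\<close> steps cost \<open>n * e * h = t * e\<close>.\<close>

lemma double_average_le:
  fixes a b :: "'s \<Rightarrow> real" and E :: "'s \<Rightarrow> 's \<Rightarrow> real"
  assumes a: "\<And>u. u \<in> G \<Longrightarrow> 0 \<le> a u" "(\<Sum>u\<in>G. a u) = 1"
    and b: "\<And>u. u \<in> G \<Longrightarrow> 0 \<le> b u" "(\<Sum>u\<in>G. b u) = 1"
    and E: "\<And>u v. u \<in> G \<Longrightarrow> v \<in> G \<Longrightarrow> \<bar>E u v\<bar> \<le> c"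
  shows "\<bar>\<Sum>u\<in>G. \<Sum>v\<in>G. a u * E u v * b v\<bar> \<le> c"
proof -
  have "\<bar>\<Sum>u\<in>G. \<Sum>v\<in>G. a u * E u v * b v\<bar> \<le> (\<Sum>u\<in>G. \<Sum>v\<in>G. \<bar>a u * E u v * b v\<bar>)"
    by (rule order_trans[OF sum_abs sum_mono[OF sum_abs]])
  also have "\<dots> \<le> (\<Sum>u\<in>G. \<Sum>v\<in>G. a u * c * b v)"
    by (intro sum_mono) (simp add: abs_mult a b E mult_left_mono mult_right_mono)
  also have "\<dots> = c"
    by (simp add: sum_distrib_left[symmetric] sum_distrib_right[symmetric] a b)
  finally show ?thesis .
qed

text \<open>
  With \<open>h = t / n\<close>, the difference \<open>p t x y - p t y x\<close> telescopes into \<open>n\<close> averages of the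
  antisymmetric part of \<open>p h\<close>, which is \<open>o(h)\<close>.
\<close>

lemma transition_function_symmetric:
  assumes fin: "finite G" and tf: "transition_function G r p"
    and sym: "\<And>x y. x \<in> G \<Longrightarrow> y \<in> G \<Longrightarrow> r x y = r y x"
    and t: "0 \<le> t" and x: "x \<in> G" and y: "y \<in> G"
  shows "p t x y = p t y x"
proof (cases "t = 0")
  case True
  with tf x y show ?thesis by (auto simp: transition_function_def)
next
  case False
  with t have t0: "0 < t" by simp
  have nonneg: "0 \<le> p s u v" if "0 \<le> s" "u \<in> G" "v \<in> G" for s u v
    using tf that by (simp add: transition_function_def)
  have rows: "(\<Sum>v\<in>G. p s u v) = 1" if "0 \<le> s" "u \<in> G" for s u
    using tf that by (simp add: transition_function_def)
  have zero: "p 0 u v = of_bool (u = v)" if "u \<in> G" "v \<in> G" for u v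
    using tf that by (simp add: transition_function_def)
  have ck: "p (s + s') u v = (\<Sum>z\<in>G. p s u z * p s' z v)"
    if "0 \<le> s" "0 \<le> s'" "u \<in> G" "v \<in> G" for s s' u v
    using tf that unfolding transition_function_def by blast
  define E where "E h u v = p h u v - p h v u" for h u v
  \<comment> \<open>Symmetric rates give a symmetric generator, so \<open>E\<close> has one-sided
    derivative 0 at 0 and value 0 there. Finiteness of \<open>G\<close> makes the bound uniform in
    \<open>u\<close> and \<open>v\<close>.\<close>
  have smallE: "\<forall>\<^sub>F h in at_right 0. \<forall>u\<in>G. \<forall>v\<in>G. \<bar>E h u v\<bar> \<le> e * h" if "0 < e" for e
  proof -
    have "\<forall>\<^sub>F h in at_right 0. \<bar>E h u v\<bar> \<le> e * h" if u: "u \<in> G" and v: "v \<in> G" for u v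
    proof -
      have gen: "generator G r u v = generator G r v u"
        using sym u v by (auto simp: generator_def)
      have "((\<lambda>h. E h u v) has_real_derivative (generator G r u v - generator G r v u)) (at_right 0)"
        unfolding E_def using tf u v
        by (intro derivative_intros) (auto simp: transition_function_def)
      then have "((\<lambda>h. (E h u v - E 0 u v) / (h - 0)) \<longlongrightarrow> 0) (at_right 0)"
        unfolding has_field_derivative_iff gen by simp
      moreover have "E 0 u v = 0" using u v by (auto simp: E_def zero)
      ultimately have "((\<lambda>h. E h u v / h) \<longlongrightarrow> 0) (at_right 0)" by simp
      then have "\<forall>\<^sub>F h in at_right 0. dist (E h u v / h) 0 < e"
        using \<open>0 < e\<close> by (rule tendstoD)
      moreover have "\<forall>\<^sub>F h in at_right 0. (0::real) < h"
        by (simp add: eventually_at_right_less)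
      ultimately show ?thesis
        by eventually_elim (simp add: dist_real_def abs_divide divide_simps)
    qed
    then show ?thesis by (simp add: fin eventually_ball_finite_distrib)
  qed
  have "\<bar>p t x y - p t y x\<bar> \<le> t * e" if e: "0 < e" for e
  proof -
    have "filterlim (\<lambda>n. t / real n) (at_right 0) sequentially"
      unfolding filterlim_at
      using t0 by (auto intro!: lim_const_over_n eventually_sequentiallyI[of 1])
    from eventually_conj[OF eventually_gt_at_top[of "0::nat"]
        eventually_compose_filterlim[OF smallE[OF e] this]]
    have "\<forall>\<^sub>F n in sequentially. 0 < n \<and> (\<forall>u\<in>G. \<forall>v\<in>G. \<bar>E (t / real n) u v\<bar> \<le> e * (t / real n))"
      .
    from eventually_happens'[OF sequentially_bot this]
    obtain n where n: "0 < n"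
      and En: "\<And>u v. u \<in> G \<Longrightarrow> v \<in> G \<Longrightarrow> \<bar>E (t / real n) u v\<bar> \<le> e * (t / real n)"
      by blast
    define h where "h = t / real n"
    have h: "0 \<le> h" "real n * h = t" using t0 n by (auto simp: h_def)
    \<comment> \<open>\<open>f\<close> interpolates between \<open>f 0 = p t y x\<close> and
      \<open>f n = p t x y\<close>. Both factors end in \<open>z\<close>, so raising
      \<open>k\<close> moves one time step of length \<open>h\<close> from the path started at
      \<open>y\<close> to the path started at \<open>x\<close>.\<close>
    define f where "f k = (\<Sum>z\<in>G. p (real k * h) x z * p (real (n - k) * h) y z)" for k
    have step: "\<bar>f (Suc k) - f k\<bar> \<le> e * h" if k: "k < n" for k
    proof -
      define m where "m = n - Suc k"
      \<comment> \<open>Besides the common \<open>k\<close> steps from \<open>x\<close> and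
        \<open>m\<close> steps from \<open>y\<close>, one step remains. It is crossed from
        \<open>u\<close> to \<open>v\<close> in \<open>f (Suc k)\<close> and from \<open>v\<close>
        to \<open>u\<close> in \<open>f k\<close>, so the difference is an average of
        \<open>E h u v\<close>.\<close>
      have nk: "n - k = Suc m" using k by (simp add: m_def)
      have kh: "0 \<le> real k * h" "0 \<le> real m * h" using h by auto
      have "f (Suc k) = (\<Sum>v\<in>G. p (real k * h + h) x v * p (real m * h) y v)"
        by (simp add: f_def m_def algebra_simps)
      also have "\<dots> = (\<Sum>v\<in>G. \<Sum>u\<in>G. p (real k * h) x u * p h u v * p (real m * h) y v)"
        using h kh x by (simp add: ck sum_distrib_right)
      also have "\<dots> = (\<Sum>u\<in>G. \<Sum>v\<in>G. p (real k * h) x u * p h u v * p (real m * h) y v)"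
        by (rule sum.swap)
      finally have 1: "f (Suc k) =
        (\<Sum>u\<in>G. \<Sum>v\<in>G. p (real k * h) x u * p h u v * p (real m * h) y v)" .
      have "f k = (\<Sum>u\<in>G. p (real k * h) x u * p (real m * h + h) y u)"
        by (simp add: f_def nk algebra_simps)
      also have "\<dots> = (\<Sum>u\<in>G. \<Sum>v\<in>G. p (real k * h) x u * p h v u * p (real m * h) y v)"
        using h kh y by (simp add: ck sum_distrib_left mult_ac)
      finally have "f (Suc k) - f k =
        (\<Sum>u\<in>G. \<Sum>v\<in>G. p (real k * h) x u * E h u v * p (real m * h) y v)"
        by (simp only: 1 E_def sum_subtractf[symmetric]) (simp add: algebra_simps)
      then show ?thesis
        using double_average_le[of G "p (real k * h) x" "p (real m * h) y" "E h" "e * h"]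
          En kh x y nonneg rows by (simp add: h_def[symmetric])
    qed
    have "f n - f 0 = (\<Sum>k<n. f (Suc k) - f k)"
      by (simp add: sum_lessThan_telescope)
    also have "\<bar>\<dots>\<bar> \<le> (\<Sum>k<n. \<bar>f (Suc k) - f k\<bar>)" by (rule sum_abs)
    also have "\<dots> \<le> (\<Sum>k<n. e * h)" by (intro sum_mono step) simp
    also have "\<dots> = t * e" using h by (simp add: mult_ac)
    finally have "\<bar>f n - f 0\<bar> \<le> t * e" .
    moreover have "f n = p t x y" "f 0 = p t y x"
      using fin x y h by (simp_all add: f_def zero)
    ultimately show ?thesis by simp
  qed
  from this[of "e / t" for e] have "\<bar>p t x y - p t y x\<bar> \<le> 0 + e" if "0 < e" for e
    using t0 that by simp
  then have "\<bar>p t x y - p t y x\<bar> \<le> 0" by (rule field_le_epsilon)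
  then show ?thesis by simp
qed

section \<open>Reversal of a Markov chain in detailed balance\<close>

context
  fixes M :: "'w measure" and G :: "'s set" and p :: "real \<Rightarrow> 's \<Rightarrow> 's \<Rightarrow> real"
    and X :: "real \<Rightarrow> 'w \<Rightarrow> 's"
  assumes M: "prob_space M" and fin: "finite G" and mc: "markov_chain M G p X"
begin

interpretation prob_space M by (rule M)

lemma chain_measurable [measurable]: "X t \<in> measurable M (count_space G)"
  using mc by (simp add: markov_chain_def)

lemma chain_in_states: "\<omega> \<in> space M \<Longrightarrow> X t \<omega> \<in> G"
  using measurable_space[OF chain_measurable] by fastforce

lemma chain_event [measurable]:
  assumes "finite J"
  shows "{\<omega> \<in> space M. \<forall>u\<in>J. X u \<omega> = a u} \<in> sets M"
proof -
  \<comment> \<open>The path \<open>a\<close> is arbitrary; a value outside \<open>G\<close> is no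
    point of \<open>count_space G\<close>, but its event is empty.\<close>
  have "{\<omega> \<in> space M. X u \<omega> = c} \<in> sets M" for u c
  proof (cases "c \<in> G")
    case True
    have "{\<omega> \<in> space M. X u \<omega> = c} = X u -` {c} \<inter> space M" by auto
    then show ?thesis using True measurable_sets[OF chain_measurable] by simp
  next
    case False
    then have "{\<omega> \<in> space M. X u \<omega> = c} = {}" using chain_in_states by blast
    then show ?thesis by simp
  qed
  then show ?thesis using assms by (intro sets.sets_Collect_finite_All) auto
qed

text \<open>The Markov property with \<open>Max J\<close> as present and the other times as past,
  multiplied out. In product form it extends to paths of probability 0, where the conditional
  probability is not prescribed but both sides vanish.\<close>

lemma path_probability_insert_max:
  assumes J: "finite J" "J \<noteq> {}" and b: "\<And>u. u \<in> J \<Longrightarrow> u < b"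
    and a: "\<And>u. u \<in> insert b J \<Longrightarrow> a u \<in> G"
  shows "\<P>(\<omega> in M. \<forall>u\<in>insert b J. X u \<omega> = a u) =
    \<P>(\<omega> in M. \<forall>u\<in>J. X u \<omega> = a u) * p (b - Max J) (a (Max J)) (a b)"
proof -
  define m where "m = Max J"
  define J' where "J' = J - {m}"
  have m: "m \<in> J" "m < b" using J b by (auto simp: m_def)
  have J'_sub: "J' \<subseteq> {..<m}"
    using J by (auto simp: J'_def m_def less_le)
  have J': "finite J'" using J by (simp add: J'_def)
  have past: "(\<forall>u\<in>J'. X u \<omega> = a u) \<and> X m \<omega> = a m \<longleftrightarrow> (\<forall>u\<in>J. X u \<omega> = a u)" for \<omega>
    using m by (auto simp: J'_def)
  show ?thesis
  proof (cases "\<P>(\<omega> in M. \<forall>u\<in>J. X u \<omega> = a u) > 0")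
    case True
    have "\<P>(\<omega> in M. X b \<omega> = a b \<bar> (\<forall>u\<in>J'. X u \<omega> = a u) \<and> X m \<omega> = a m) = p (b - m) (a m) (a b)"
      using mc[unfolded markov_chain_def, THEN conjunct2, rule_format, of "a m" "a b" m b J' a]
        a m J' J'_sub True by (simp only: past) auto
    then show ?thesis
      using True unfolding past cond_prob_def by (simp add: m_def[symmetric] field_simps)
  next
    case False
    then have 0: "\<P>(\<omega> in M. \<forall>u\<in>J. X u \<omega> = a u) = 0"
      by (simp add: zero_less_measure_iff)
    have "\<P>(\<omega> in M. \<forall>u\<in>insert b J. X u \<omega> = a u) \<le> \<P>(\<omega> in M. \<forall>u\<in>J. X u \<omega> = a u)"
      using J by (intro finite_measure_mono chain_event) auto
    then show ?thesis using 0 by (simp add: measure_le_0_iff)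
  qed
qed

context
  fixes \<pi> :: "'s \<Rightarrow> real"
  assumes law: "\<And>t x. x \<in> G \<Longrightarrow> \<P>(\<omega> in M. X t \<omega> = x) = \<pi> x"
    and balance: "\<And>t x y. 0 \<le> t \<Longrightarrow> x \<in> G \<Longrightarrow> y \<in> G \<Longrightarrow> \<pi> x * p t x y = \<pi> y * p t y x"
begin

text \<open>The backward Markov property in product form. Detailed balance gives it for the two
  times \<open>s\<close> and \<open>t\<close>; later times are then appended in increasing order,
  each multiplying both sides by the same forward transition probability.\<close>

lemma path_probability_insert_min:
  assumes "finite J" and st: "s < t" and "\<And>u. u \<in> J \<Longrightarrow> t < u"
    and "\<And>u. u \<in> insert s (insert t J) \<Longrightarrow> a u \<in> G"
  shows "\<P>(\<omega> in M. \<forall>u\<in>insert s (insert t J). X u \<omega> = a u) =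
    \<P>(\<omega> in M. \<forall>u\<in>insert t J. X u \<omega> = a u) * p (t - s) (a t) (a s)"
  using assms(1,3,4)
proof (induction J rule: finite_linorder_max_induct)
  case empty
  have "\<P>(\<omega> in M. \<forall>u\<in>insert t {s}. X u \<omega> = a u) = \<pi> (a s) * p (t - s) (a s) (a t)"
    using path_probability_insert_max[of "{s}" t a] empty.prems(2) st law
    by auto
  then show ?case
    using empty st law balance[of "t - s" "a s" "a t"] by (simp add: insert_commute)
next
  case (insert b J)
  \<comment> \<open>The early time \<open>s\<close> does not change the latest observation before
    \<open>b\<close>, so appending \<open>b\<close> yields the same factor with and without
    \<open>s\<close>.\<close>
  have max: "Max (insert s (insert t J)) = Max (insert t J)"
    using order_trans[OF less_imp_le[OF st] Max_ge[of "insert t J" t]] insert.hyps(1)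
    by (simp add: Max_insert[of "insert t J" s] max_absorb2 del: Max_insert)
  have below: "u < b" if "u \<in> insert s (insert t J)" for u
    using that st insert.hyps(2) insert.prems(1)[of b] by auto
  have "\<P>(\<omega> in M. \<forall>u\<in>insert b (insert s (insert t J)). X u \<omega> = a u) =
      \<P>(\<omega> in M. \<forall>u\<in>insert s (insert t J). X u \<omega> = a u) *
        p (b - Max (insert t J)) (a (Max (insert t J))) (a b)"
    unfolding max[symmetric] using insert.hyps(1) below insert.prems(2)
    by (intro path_probability_insert_max) auto
  moreover have "\<P>(\<omega> in M. \<forall>u\<in>insert b (insert t J). X u \<omega> = a u) =
      \<P>(\<omega> in M. \<forall>u\<in>insert t J. X u \<omega> = a u) *
        p (b - Max (insert t J)) (a (Max (insert t J))) (a b)"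
    using insert.hyps(1) below insert.prems(2) by (intro path_probability_insert_max) auto
  moreover have "\<P>(\<omega> in M. \<forall>u\<in>insert s (insert t J). X u \<omega> = a u) =
      \<P>(\<omega> in M. \<forall>u\<in>insert t J. X u \<omega> = a u) * p (t - s) (a t) (a s)"
    using insert.prems by (intro insert.IH) auto
  moreover have "insert s (insert t (insert b J)) = insert b (insert s (insert t J))"
    "insert t (insert b J) = insert b (insert t J)"
    by auto
  ultimately show ?case by (simp only: mult_ac)
qed

text \<open>Induction on the latest time \<open>b\<close>. Negation turns it into the earliest time,
  so the forward factor for \<open>X\<close> and the backward factor for the reversed process are
  both \<open>p (b - m) (a m) (a b)\<close> with \<open>m = Max J\<close>. A single time is settled
  by stationarity.\<close>

lemma path_probability_reversed:
  assumes "finite J" and "\<And>u. u \<in> J \<Longrightarrow> a u \<in> G"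
  shows "\<P>(\<omega> in M. \<forall>u\<in>J. X u \<omega> = a u) = \<P>(\<omega> in M. \<forall>u\<in>J. X (- u) \<omega> = a u)"
  using assms
proof (induction J rule: finite_linorder_max_induct)
  case empty
  then show ?case by simp
next
  case (insert b J)
  show ?case
  proof (cases "J = {}")
    case True
    then show ?thesis using insert.prems law by simp
  next
    case False
    define m where "m = Max J"
    \<comment> \<open>After negation \<open>- m\<close> is the least of the old times and
      \<open>L\<close> holds those to its right; a negated time \<open>u\<close> carries the value
      \<open>a (- u)\<close>.\<close>
    define L where "L = uminus ` (J - {m})"
    have m: "m \<in> J" "m < b" using insert.hyps False by (auto simp: m_def)
    have "- m < u" if "u \<in> L" for u
      using that insert.hyps by (auto simp: L_def m_def less_le)
    moreover have "finite L" using insert.hyps by (simp add: L_def)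
    moreover have "a (- u) \<in> G" if "u \<in> insert (- b) (insert (- m) L)" for u
      using that insert.prems m by (auto simp: L_def)
    ultimately have "\<P>(\<omega> in M. \<forall>u\<in>insert (- b) (insert (- m) L). X u \<omega> = a (- u)) =
        \<P>(\<omega> in M. \<forall>u\<in>insert (- m) L. X u \<omega> = a (- u)) * p (b - m) (a m) (a b)"
      using path_probability_insert_min[of L "- b" "- m" "\<lambda>u. a (- u)"] m by simp
    moreover have "insert (- m) L = uminus ` J" using m by (auto simp: L_def)
    ultimately have "\<P>(\<omega> in M. \<forall>u\<in>insert b J. X (- u) \<omega> = a u) =
        \<P>(\<omega> in M. \<forall>u\<in>J. X (- u) \<omega> = a u) * p (b - m) (a m) (a b)"
      by simp
    then show ?thesis
      using path_probability_insert_max[of J b a] insert False by (simp add: m_def)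
  qed
qed

text \<open>A finite product of copies of the finite space \<open>G\<close> is again a finite
  counting space, so the two laws need only be compared on single paths.\<close>

lemma same_fdd_reversed: "same_fdd M X M (\<lambda>t. X (- t)) (count_space G)"
  unfolding same_fdd_def
proof (intro allI impI)
  fix J :: "real set"
  assume J: "finite J"
  have PiM: "Pi\<^sub>M J (\<lambda>_. count_space G) = count_space (J \<rightarrow>\<^sub>E G)"
    using J fin by (intro count_space_PiM_finite) (auto simp: countable_finite)
  have meas: "(\<lambda>\<omega>. \<lambda>t\<in>J. X (f t) \<omega>) \<in> measurable M (Pi\<^sub>M J (\<lambda>_. count_space G))"
    for f :: "real \<Rightarrow> real"
    by (intro measurable_restrict chain_measurable)
  have point: "emeasure (distr M (Pi\<^sub>M J (\<lambda>_. count_space G)) (\<lambda>\<omega>. \<lambda>t\<in>J. X (f t) \<omega>)) {a} =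
      \<P>(\<omega> in M. \<forall>u\<in>J. X (f u) \<omega> = a u)" if a: "a \<in> J \<rightarrow>\<^sub>E G" for a and f :: "real \<Rightarrow> real"
  proof -
    have "(\<lambda>t\<in>J. X (f t) \<omega>) = a \<longleftrightarrow> (\<forall>u\<in>J. X (f u) \<omega> = a u)" for \<omega>
      using a by (auto simp: fun_eq_iff PiE_def extensional_def)
    then have "(\<lambda>\<omega>. \<lambda>t\<in>J. X (f t) \<omega>) -` {a} \<inter> space M = {\<omega> \<in> space M. \<forall>u\<in>J. X (f u) \<omega> = a u}"
      by auto
    then show ?thesis
      using a by (subst emeasure_distr[OF meas]) (simp_all add: PiM emeasure_eq_measure)
  qed
  show "distr M (Pi\<^sub>M J (\<lambda>_. count_space G)) (\<lambda>\<omega>. \<lambda>t\<in>J. X t \<omega>) =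
      distr M (Pi\<^sub>M J (\<lambda>_. count_space G)) (\<lambda>\<omega>. \<lambda>t\<in>J. X (- t) \<omega>)"
  proof (rule measure_eqI_finite[where A = "J \<rightarrow>\<^sub>E G"])
    fix a assume a: "a \<in> J \<rightarrow>\<^sub>E G"
    then have "a u \<in> G" if "u \<in> J" for u using that by auto
    then have "\<P>(\<omega> in M. \<forall>u\<in>J. X u \<omega> = a u) = \<P>(\<omega> in M. \<forall>u\<in>J. X (- u) \<omega> = a u)"
      using J by (intro path_probability_reversed) auto
    then show "emeasure (distr M (Pi\<^sub>M J (\<lambda>_. count_space G)) (\<lambda>\<omega>. \<lambda>t\<in>J. X t \<omega>)) {a} =
        emeasure (distr M (Pi\<^sub>M J (\<lambda>_. count_space G)) (\<lambda>\<omega>. \<lambda>t\<in>J. X (- t) \<omega>)) {a}"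
      using point[OF a, of "\<lambda>t. t"] point[OF a, of uminus] by simp
  qed (use J fin in \<open>simp_all add: PiM finite_PiE\<close>)
qed

end

end

theorem stationary_symmetric_chain_reversible:
  assumes M: "prob_space M" and fin: "finite G"
    and sym: "\<And>x y. x \<in> G \<Longrightarrow> y \<in> G \<Longrightarrow> r x y = r y x"
    and chain: "stationary_markov_chain M G r X"
  shows "same_fdd M X M (\<lambda>t. X (- t)) (count_space G)"
proof -
  obtain p \<pi> where tf: "transition_function G r p" and mc: "markov_chain M G p X"
    and stat: "stationary_distribution G p \<pi>"
    and law: "\<forall>t. \<forall>x\<in>G. \<P>(\<omega> in M. X t \<omega> = x) = \<pi> x"
    using chain unfolding stationary_markov_chain_def by blast
  \<comment> \<open>For each fixed \<open>t\<close>, \<open>p t\<close> is a symmetric stochastic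
    matrix with stationary vector \<open>\<pi>\<close>.\<close>
  have "\<pi> x * p t x y = \<pi> y * p t y x" if "0 \<le> t" "x \<in> G" "y \<in> G" for t x y
  proof (rule stationary_symmetric_detailed_balance[OF fin])
    show "p t u v = p t v u" if "u \<in> G" "v \<in> G" for u v
      using transition_function_symmetric[OF fin tf] sym that \<open>0 \<le> t\<close> by blast
  qed (use that tf stat in \<open>auto simp: transition_function_def stationary_distribution_def\<close>)
  then show ?thesis
    using same_fdd_reversed[OF M fin mc] law by blast
qed

section \<open>The exclusion process\<close>

lemma sep_rate_symmetric:
  assumes "\<And>k. k \<in> {1..K} \<Longrightarrow> \<alpha> k = \<beta> k"
  shows "sep_rate N K \<alpha> \<beta> \<delta> x y = sep_rate N K \<alpha> \<beta> \<delta> y x"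
proof -
  have boundary: "x i = 0 \<and> y = x(i := k) \<longleftrightarrow> y i = k \<and> x = y(i := 0)"
    for i k and x y :: "nat \<Rightarrow> nat"
    by auto
  \<comment> \<open>The reverse hop goes from \<open>j\<close> to \<open>i\<close>, so the indices
    trade places; swapping the two sums restores their order.\<close>
  have hop: "(j = i + 1 \<or> i = j + 1) \<and> x i = k \<and> x j = 0 \<and> y = x(i := 0, j := k) \<longleftrightarrow>
      (i = j + 1 \<or> j = i + 1) \<and> y j = k \<and> y i = 0 \<and> x = y(j := 0, i := k)"
    for i j k and x y :: "nat \<Rightarrow> nat"
    by (intro iffI) (auto intro!: ext)
  have "(\<Sum>i\<in>{1..N}. \<Sum>j\<in>{1..N}.
        if (j = i + 1 \<or> i = j + 1) \<and> x i = k \<and> x j = 0 \<and> y = x(i := 0, j := k) then \<delta> k else 0) =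
      (\<Sum>i\<in>{1..N}. \<Sum>j\<in>{1..N}.
        if (j = i + 1 \<or> i = j + 1) \<and> y i = k \<and> y j = 0 \<and> x = y(i := 0, j := k) then \<delta> k else 0)"
    for k
    by (subst hop, subst sum.swap) (rule refl)
  moreover have "(\<Sum>i\<in>{1, N}. if x i = 0 \<and> y = x(i := k) then \<alpha> k else 0) =
      (\<Sum>i\<in>{1, N}. if y i = k \<and> x = y(i := 0) then \<beta> k else 0)"
    "(\<Sum>i\<in>{1, N}. if x i = k \<and> y = x(i := 0) then \<beta> k else 0) =
      (\<Sum>i\<in>{1, N}. if y i = 0 \<and> x = y(i := k) then \<alpha> k else 0)"
    if "k \<in> {1..K}" for k
    by (simp_all only: boundary[of x _ y k] boundary[of y _ x k] assms[OF that])
  \<comment> \<open>The arrival sum for one direction is the departure sum for the other, so these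
    two summands are exchanged while the hop sum stays in place.\<close>
  ultimately show ?thesis
    unfolding sep_rate_def by (intro sum.cong refl) (simp only: add.commute)
qed

theorem theorem8:
  fixes N K :: nat and \<alpha> \<beta> \<delta> :: "nat \<Rightarrow> real"
    and M :: "'w measure" and X :: "real \<Rightarrow> 'w \<Rightarrow> nat \<Rightarrow> nat"
  assumes "N \<ge> 2" and "K \<ge> 1"
    and "\<And>k. k \<in> {1..K} \<Longrightarrow> \<alpha> k > 0"
    and "\<And>k. k \<in> {1..K} \<Longrightarrow> \<beta> k > 0"
    and "\<And>k. k \<in> {1..K} \<Longrightarrow> \<delta> k > 0"
    and "\<And>k. k \<in> {1..K} \<Longrightarrow> \<alpha> k = \<beta> k"
    and "prob_space M"
    and "stationary_markov_chain M (sep_states N K) (sep_rate N K \<alpha> \<beta> \<delta>) X"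
  shows "same_fdd M X M (\<lambda>t. X (- t)) (count_space (sep_states N K))"
proof (rule stationary_symmetric_chain_reversible)
  show "finite (sep_states N K)"
    by (simp add: sep_states_def finite_PiE)
  show "sep_rate N K \<alpha> \<beta> \<delta> x y = sep_rate N K \<alpha> \<beta> \<delta> y x" for x y
    using assms(6) by (rule sep_rate_symmetric)
qed (fact assms)+

end
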